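(* Let $\mathcal{W}\subset\mathbb{R}^d$ ($d=2$ or $3$) be a polytope, let the obstacle set $\mathcal{O}\subset\mathcal{W}$ be closed in $\mathcal{W}$, and define the free space $\mathcal{F}=\mathcal{W}\setminus\mathcal{O}$. Let $\mathcal{P}$ be a finite set of points sampled from the boundaries of the obstacles $\mathcal{O}$. Let $\Pi=\{\mathrm{y}_0,\dots,\mathrm{y}_L\}\subset\mathcal{F}$ be a collection of waypoints such that the line segment connecting any two successive waypoints $\mathrm{y}_{\ell-1}$ and $\mathrm{y}_\ell$ lies entirely in the interior of $\mathcal{F}$, and let $\Gamma(\Pi)=\bigcup_{\ell=1}^{L}[\mathrm{y}_{\ell-1},\mathrm{y}_\ell]$ be the piecewise linear path they define. Then the algorithm $\texttt{PathCover}$ computes a finite sequence of polytopes $\mathcal{G}=\{\mathcal{H}_1,\dots,\mathcal{H}_J\}$ satisfying the following path coverage conditions: 1. each polytope $\mathcal{H}_j$, $j\in\{1,\dots,J\}$, is strictly separated from every point in $\mathcal{P}$; 2. $\mathcal{H}_j\cap\mathcal{H}_{j+1}\neq\emptyset$ for $j\in\{1,\dots,J-1\}$; 3. $\Gamma(\Pi)\subset\bigcup_{j=1}^{J}\mathcal{H}_j$.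
   Context: A polytope is a bounded intersection of finitely many closed half-spaces of $\mathbb{R}^d$. $[\mathrm{y},\mathrm{y}']=\{(1-t)\mathrm{y}+t\mathrm{y}'\mid t\in[0,1]\}$. A set is strictly separated from a point $\mathrm{p}$ if there are $\mathrm{c}\in\mathbb{R}^d$, $\gamma\in\mathbb{R}$ with $\mathrm{c}^\top\mathrm{x}<\gamma$ for all $\mathrm{x}$ in the set and $\mathrm{c}^\top\mathrm{p}>\gamma$. Algorithm $\texttt{RISP}(\mathrm{y}_{\rm seed},\mathcal{P},\alpha)$, with parameter $\alpha\in(0,1)$: while $\mathcal{P}$ is not empty, select a point $\mathrm{p}$ from $\mathcal{P}$ uniformly at random; compute $\mathrm{a}=\mathrm{p}-\mathrm{y}_{\rm seed}$ and $\mathrm{b}=\mathrm{a}^\top\mathrm{y}_{\rm seed}+(1-\alpha)\|\mathrm{a}\|_2^2$; remove from $\mathcal{P}$ every $\mathrm{q}$ with $\mathrm{a}^\top\mathrm{q}>\mathrm{b}$; and append the half-space $\{\mathrm{x}\mid\mathrm{a}^\top\mathrm{x}\le\mathrm{b}\}$ to the description of $\mathcal{H}$. When no points remain, append the half-spaces defining $\mathcal{W}$, remove redundant half-spaces, and return the resulting intersection of half-spaces $\mathcal{H}$. Algorithm $\texttt{PathCover}(\Pi,\mathcal{P},\mathtt{max\_iter},\alpha)$, with $\mathrm{y}_{\rm goal}=\mathrm{y}_L$ and $\alpha\in(0,1)$: set $\mathcal{H}_{\rm new}\gets\texttt{RISP}(\mathrm{y}_0,\mathcal{P},\alpha)$,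 $\ell\gets0$, and initialize the list $\mathcal{G}$ with $\mathcal{H}_{\rm new}$. While $\mathrm{y}_{\rm goal}\notin\mathcal{H}_{\rm new}$ or $\ell<L$: if $\mathrm{y}_\ell\in\mathcal{H}_{\rm new}$, set $\mathrm{y}_{\rm in}\gets\mathrm{y}_\ell$ and $\ell\gets\ell+1$; otherwise, if the size of $\mathcal{G}$ equals $\mathtt{max\_iter}$, exit the loop, and else set $\mathrm{y}_{\rm in}\gets\texttt{PolyLineIntersect}(\mathcal{H}_{\rm new},\mathrm{y}_{\rm in},\mathrm{y}_\ell)$, then $\mathcal{H}_{\rm new}\gets\texttt{RISP}(\mathrm{y}_{\rm in},\mathcal{P},\alpha)$, and append $\mathcal{H}_{\rm new}$ to $\mathcal{G}$. Return $\mathcal{G}$. Each call of $\texttt{RISP}$ is made with the full set $\mathcal{P}$. $\texttt{PolyLineIntersect}(\mathcal{H}_{\rm new},\mathrm{y}_{\rm in},\mathrm{y}_\ell)$ is the intersection point of the boundary of $\mathcal{H}_{\rm new}$ with the line segment connecting the last known covered point $\mathrm{y}_{\rm in}\in\mathcal{H}_{\rm new}$ and $\mathrm{y}_\ell\notin\mathcal{H}_{\rm new}$ (the point where the segment leaves $\mathcal{H}_{\rm new}$).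
   Formalization: The claim is proved for all sufficiently large max_iter (including no limit), with a threshold depending on the input data; for arbitrary max_iter it fails, since PathCover may exit before the path is covered. *)

theory Defs
  imports "HOL-Analysis.Analysis" "HOL-Probability.SPMF"
begin

definition closed_halfspace :: "'a::euclidean_space set \<Rightarrow> bool" where
  "closed_halfspace h \<longleftrightarrow> (\<exists>a b. a \<noteq> 0 \<and> h = {x. a \<bullet> x \<le> b})"

text \<open>The descriptions handled by the algorithms are finite sets of closed half-spaces; the
  described set is their intersection.  For bounded \<open>W\<close> the following says that \<open>W\<close> is a polytope
  given by the half-spaces in \<open>D\<close>.\<close>

definition halfspace_description :: "'a::euclidean_space set set \<Rightarrow> 'a set \<Rightarrow> bool" where
  "halfspace_description D W \<longleftrightarrow> finite D \<and> (\<forall>h\<in>D. closed_halfspace h) \<and> W = \<Inter>D"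

definition strictly_separated :: "'a::euclidean_space set \<Rightarrow> 'a \<Rightarrow> bool" where
  "strictly_separated S p \<longleftrightarrow> (\<exists>c \<gamma>. (\<forall>x\<in>S. c \<bullet> x < \<gamma>) \<and> c \<bullet> p > \<gamma>)"

text \<open>Which irredundant subdescription is selected is left open, as it does not affect the
  intersection.\<close>

definition remove_redundant :: "'a set set \<Rightarrow> 'a set set" where
  "remove_redundant D =
    (SOME D'. D' \<subseteq> D \<and> \<Inter>D' = \<Inter>D \<and> (\<forall>h\<in>D'. \<Inter>(D' - {h}) \<noteq> \<Inter>D'))"

text \<open>The algorithms are probabilistic programs in the monad of subprobability mass functions:
  the missing mass of a result is the probability of nontermination, and \<^const>\<open>set_spmf\<close> is the
  set of the outputs that occur with positive probability.  The loops are least fixed points.\<close>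

definition offset :: "'a::euclidean_space \<Rightarrow> real \<Rightarrow> 'a \<Rightarrow> real" where
  "offset seed \<alpha> p = (let a = p - seed in a \<bullet> seed + (1 - \<alpha>) * (norm a)\<^sup>2)"

partial_function (spmf) risp_loop ::
    "'a::euclidean_space \<Rightarrow> real \<Rightarrow> 'a set \<Rightarrow> 'a set set \<Rightarrow> 'a set set spmf" where
  "risp_loop seed \<alpha> P D =
    (if P = {} then return_spmf D
     else bind_spmf (spmf_of_set P) (\<lambda>p.
       risp_loop seed \<alpha>
         (P - {q. (p - seed) \<bullet> q > offset seed \<alpha> p})
         (insert {x. (p - seed) \<bullet> x \<le> offset seed \<alpha> p} D)))"

definition risp :: "'a::euclidean_space set set \<Rightarrow> 'a \<Rightarrow> 'a set \<Rightarrow> real \<Rightarrow> 'a set spmf" where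
  "risp HW seed P \<alpha> =
    map_spmf (\<lambda>D. \<Inter>(remove_redundant (D \<union> HW))) (risp_loop seed \<alpha> P {})"

text \<open>The boundary of \<open>H\<close> may meet the segment in several points, for instance if \<open>y_in\<close> itself is
  a boundary point; the intended one is the last point of the segment in \<open>H\<close>.\<close>

definition polyline_intersect :: "'a::euclidean_space set \<Rightarrow> 'a \<Rightarrow> 'a \<Rightarrow> 'a" where
  "polyline_intersect H y_in v =
    (THE z. z \<in> frontier H \<inter> closed_segment y_in v \<and> closed_segment z v \<inter> H = {z})"

text \<open>The extended natural number \<open>max_iter\<close> admits \<open>\<infinity>\<close>, meaning no limit on the
  length of the list.\<close>

partial_function (spmf) path_cover_loop ::
    "'a::euclidean_space set set \<Rightarrow> (nat \<Rightarrow> 'a) \<Rightarrow> nat \<Rightarrow> 'a set \<Rightarrow> enat \<Rightarrow> real \<Rightarrow>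
     'a set \<Rightarrow> 'a \<Rightarrow> nat \<Rightarrow> 'a set list \<Rightarrow> 'a set list spmf" where
  "path_cover_loop HW y L P max_iter \<alpha> H y_in l G =
    (if y L \<notin> H \<or> l < L then
       if y l \<in> H then path_cover_loop HW y L P max_iter \<alpha> H (y l) (l + 1) G
       else if enat (length G) = max_iter then return_spmf G
       else bind_spmf (risp HW (polyline_intersect H y_in (y l)) P \<alpha>) (\<lambda>H'.
         path_cover_loop HW y L P max_iter \<alpha> H' (polyline_intersect H y_in (y l)) l (G @ [H']))
     else return_spmf G)"

text \<open>The waypoints are \<open>y 0, \<dots>, y L\<close>.  The pseudocode leaves \<open>y_in\<close> uninitialised; as
  \<open>y 0\<close> belongs to the first polytope, \<open>y_in\<close> is assigned before it is first read, and the initial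
  value below is a placeholder.\<close>

definition path_cover ::
    "'a::euclidean_space set set \<Rightarrow> (nat \<Rightarrow> 'a) \<Rightarrow> nat \<Rightarrow> 'a set \<Rightarrow> enat \<Rightarrow> real \<Rightarrow>
     'a set list spmf" where
  "path_cover HW y L P max_iter \<alpha> =
    bind_spmf (risp HW (y 0) P \<alpha>) (\<lambda>H.
      path_cover_loop HW y L P max_iter \<alpha> H (y 0) 0 [H])"

definition polyline :: "(nat \<Rightarrow> 'a::euclidean_space) \<Rightarrow> nat \<Rightarrow> 'a set" where
  "polyline y L = (\<Union>l\<in>{1..L}. closed_segment (y (l - 1)) (y l))"

end

theory Submission
  imports Defs
begin

text \<open>Every polytope computed from a seed \<open>s\<close> on the path contains \<open>cball s r \<inter> W\<close>, where \<open>r\<close> is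
  \<open>1 - \<alpha>\<close> times the distance between the path and \<open>P\<close>; both sets are compact and disjoint, so
  \<open>r > 0\<close>.  Since the path stays in \<open>W\<close>, a segment that starts at a seed leaves the polytope only
  after a length of at least \<open>r\<close>.  A polytope may however be left at a waypoint it was not seeded
  at, without any progress; this happens at most once per waypoint, which bounds the number of
  polytopes by \<open>T / r + L + 1\<close>, where \<open>T\<close> is the length of the path.\<close>

section \<open>Separation by a single region\<close>

text \<open>The half-space that \<open>risp_loop\<close> appends for the sample \<open>p\<close>.
  The samples removed in that round are exactly those outside it, so the loop continues with
  \<open>P \<inter> cut s \<alpha> p\<close>.\<close>

definition cut :: "'a::euclidean_space \<Rightarrow> real \<Rightarrow> 'a \<Rightarrow> 'a set" where
  "cut s \<alpha> p = {x. (p - s) \<bullet> x \<le> offset s \<alpha> p}"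

text \<open>Relative to the seed, the bounding hyperplane is orthogonal to \<open>p - s\<close> and
  passes through the point at fraction \<open>1 - \<alpha>\<close> of the way from \<open>s\<close>
  to \<open>p\<close>.\<close>

lemma mem_cut_iff: "x \<in> cut s \<alpha> p \<longleftrightarrow> (p - s) \<bullet> (x - s) \<le> (1 - \<alpha>) * (norm (p - s))\<^sup>2"
  by (auto simp: cut_def offset_def Let_def inner_diff_right)

text \<open>This makes \<open>risp_loop\<close> terminate: the selected sample is always among the
  removed ones.\<close>

lemma not_mem_cut_self:
  assumes "p \<noteq> s" "0 < \<alpha>"
  shows "p \<notin> cut s \<alpha> p"
proof -
  have "0 < (norm (p - s))\<^sup>2"
    using assms by simp
  then have "(1 - \<alpha>) * (norm (p - s))\<^sup>2 < (norm (p - s))\<^sup>2"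
    using assms by (simp add: algebra_simps)
  then show ?thesis
    by (simp add: mem_cut_iff power2_norm_eq_inner)
qed

text \<open>By Cauchy-Schwarz: no point of the ball advances further in the direction
  \<open>p - s\<close> than the hyperplane allows.\<close>

lemma cball_subset_cut:
  assumes "r \<le> (1 - \<alpha>) * dist p s"
  shows "cball s r \<subseteq> cut s \<alpha> p"
proof
  fix x assume "x \<in> cball s r"
  then have "norm (x - s) \<le> (1 - \<alpha>) * norm (p - s)"
    using assms by (simp add: dist_norm norm_minus_commute)
  then have "norm (p - s) * norm (x - s) \<le> norm (p - s) * ((1 - \<alpha>) * norm (p - s))"
    by (intro mult_left_mono) auto
  with norm_cauchy_schwarz[of "p - s" "x - s"] show "x \<in> cut s \<alpha> p"
    by (simp add: mem_cut_iff power2_eq_square algebra_simps)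
qed

lemma strictly_separated_cut:
  assumes "H \<subseteq> cut s \<alpha> p" "q \<notin> cut s \<alpha> p"
  shows "strictly_separated H q"
proof -
  \<comment> \<open>\<open>H\<close> may touch the bounding hyperplane, so the threshold is moved
    halfway towards \<open>q\<close> to make both inequalities strict.\<close>
  let ?\<gamma> = "(offset s \<alpha> p + (p - s) \<bullet> q) / 2"
  have "(p - s) \<bullet> q > offset s \<alpha> p"
    using assms(2) by (simp add: cut_def)
  moreover have "(p - s) \<bullet> x \<le> offset s \<alpha> p" if "x \<in> H" for x
    using assms(1) that by (auto simp: cut_def)
  ultimately have "(\<forall>x\<in>H. (p - s) \<bullet> x < ?\<gamma>) \<and> (p - s) \<bullet> q > ?\<gamma>"
    by fastforce
  then show ?thesis
    unfolding strictly_separated_def by blast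
qed

section \<open>Termination and output of \<open>risp\<close>\<close>

text \<open>\<open>Q\<close> is the set of selected samples. The loop stops only when no sample is
  left, so each sample was removed by the cut of a selected one. Every round shrinks
  \<open>P\<close> strictly, whatever the random choice, hence no probability mass is lost.\<close>

lemma risp_loop_correct:
  assumes "finite P" "s \<notin> P" "0 < \<alpha>"
  shows "lossless_spmf (risp_loop s \<alpha> P D) \<and>
    (\<forall>E\<in>set_spmf (risp_loop s \<alpha> P D).
      \<exists>Q\<subseteq>P. E = D \<union> cut s \<alpha> ` Q \<and> (\<forall>q\<in>P. \<exists>p\<in>Q. q \<notin> cut s \<alpha> p))"
  using assms
proof (induction P arbitrary: D rule: finite_psubset_induct)
  case (psubset P)
  show ?case
  proof (cases "P = {}")
    case True
    then show ?thesis
      by (subst (1 2) risp_loop.simps) simp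
  next
    case False
    have unfold: "risp_loop s \<alpha> P D =
      bind_spmf (spmf_of_set P) (\<lambda>p. risp_loop s \<alpha> (P \<inter> cut s \<alpha> p) (insert (cut s \<alpha> p) D))"
      using False by (subst risp_loop.simps) (auto simp: cut_def intro!: bind_spmf_cong arg_cong2[where f="risp_loop s \<alpha>"])
    have IH: "lossless_spmf (risp_loop s \<alpha> (P \<inter> cut s \<alpha> p) D') \<and>
       (\<forall>E\<in>set_spmf (risp_loop s \<alpha> (P \<inter> cut s \<alpha> p) D'). \<exists>Q\<subseteq>P \<inter> cut s \<alpha> p.
          E = D' \<union> cut s \<alpha> ` Q \<and> (\<forall>q\<in>P \<inter> cut s \<alpha> p. \<exists>p\<in>Q. q \<notin> cut s \<alpha> p))"
      if "p \<in> P" for p D'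
    proof (rule psubset.IH)
      have "p \<noteq> s"
        using that psubset.prems by auto
      then show "P \<inter> cut s \<alpha> p \<subset> P"
        using that not_mem_cut_self[of p s \<alpha>] psubset.prems by auto
    qed (use psubset.prems in auto)
    have "\<exists>Q\<subseteq>P. E = D \<union> cut s \<alpha> ` Q \<and> (\<forall>q\<in>P. \<exists>p\<in>Q. q \<notin> cut s \<alpha> p)"
      if "E \<in> set_spmf (risp_loop s \<alpha> P D)" for E
    proof -
      from that obtain p where p: "p \<in> P"
        and "E \<in> set_spmf (risp_loop s \<alpha> (P \<inter> cut s \<alpha> p) (insert (cut s \<alpha> p) D))"
        using psubset.hyps by (auto simp: unfold set_bind_spmf)
      then obtain Q where Q: "Q \<subseteq> P \<inter> cut s \<alpha> p" "E = insert (cut s \<alpha> p) D \<union> cut s \<alpha> ` Q"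
        "\<forall>q\<in>P \<inter> cut s \<alpha> p. \<exists>p\<in>Q. q \<notin> cut s \<alpha> p"
        using IH[OF p] by meson
      then show ?thesis
        \<comment> \<open>Samples outside \<open>cut s \<alpha> p\<close> are handled by
          \<open>p\<close>, the others by \<open>Q\<close>.\<close>
        using p by (intro exI[of _ "insert p Q"]) auto
    qed
    moreover have "lossless_spmf (risp_loop s \<alpha> P D)"
      using IH False psubset.hyps by (simp add: unfold)
    ultimately show ?thesis
      by blast
  qed
qed

lemma Inter_remove_redundant:
  assumes "finite D"
  shows "\<Inter>(remove_redundant D) = \<Inter>D"
proof -
  have "\<exists>D'\<subseteq>D. \<Inter>D' = \<Inter>D \<and> (\<forall>h\<in>D'. \<Inter>(D' - {h}) \<noteq> \<Inter>D')"
    using assms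
  proof (induction D rule: finite_psubset_induct)
    case (psubset D)
    show ?case
    proof (cases "\<exists>h\<in>D. \<Inter>(D - {h}) = \<Inter>D")
      case True
      then obtain h where h: "h \<in> D" "\<Inter>(D - {h}) = \<Inter>D"
        by blast
      then have "D - {h} \<subset> D"
        by blast
      from psubset.IH[OF this] h show ?thesis
        by (metis Diff_subset order_trans)
    qed blast
  qed
  from someI_ex[OF this] show ?thesis
    unfolding remove_redundant_def by blast
qed

lemma risp_correct:
  assumes "finite P" "s \<notin> P" "0 < \<alpha>" "halfspace_description HW W"
  shows "lossless_spmf (risp HW s P \<alpha>)"
    and "H \<in> set_spmf (risp HW s P \<alpha>) \<Longrightarrow>
      \<exists>Q\<subseteq>P. H = \<Inter>(cut s \<alpha> ` Q) \<inter> W \<and> (\<forall>q\<in>P. \<exists>p\<in>Q. q \<notin> cut s \<alpha> p)"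
proof -
  note loop = risp_loop_correct[OF assms(1-3), where D = "{}"]
  show "lossless_spmf (risp HW s P \<alpha>)"
    using loop by (simp add: risp_def)
  assume "H \<in> set_spmf (risp HW s P \<alpha>)"
  then obtain D where "D \<in> set_spmf (risp_loop s \<alpha> P {})" and H: "H = \<Inter>(remove_redundant (D \<union> HW))"
    by (auto simp: risp_def)
  then obtain Q where Q: "Q \<subseteq> P" "D = cut s \<alpha> ` Q" "\<forall>q\<in>P. \<exists>p\<in>Q. q \<notin> cut s \<alpha> p"
    using loop by auto
  have "finite (D \<union> HW)"
    using Q assms(1,4) by (auto simp: halfspace_description_def intro: finite_subset)
  then have "H = \<Inter>(cut s \<alpha> ` Q) \<inter> W"
    using H Q assms(4) by (simp add: Inter_remove_redundant halfspace_description_def Inter_Un_distrib)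
  with Q show "\<exists>Q\<subseteq>P. H = \<Inter>(cut s \<alpha> ` Q) \<inter> W \<and> (\<forall>q\<in>P. \<exists>p\<in>Q. q \<notin> cut s \<alpha> p)"
    by blast
qed

lemma polyhedron_halfspace_description:
  assumes "halfspace_description D W"
  shows "polyhedron W"
  using assms unfolding halfspace_description_def closed_halfspace_def polyhedron_def by blast

lemma polyhedron_cut: "polyhedron (cut s \<alpha> p)"
  unfolding cut_def by (rule polyhedron_halfspace_le)

lemma risp_output:
  assumes "finite P" "s \<notin> P" "0 < \<alpha>" "halfspace_description HW W" "bounded W"
    and "H \<in> set_spmf (risp HW s P \<alpha>)"
  shows "polyhedron H" "bounded H" "\<forall>p\<in>P. strictly_separated H p"
    and "\<forall>p\<in>P. r \<le> (1 - \<alpha>) * dist p s \<Longrightarrow> cball s r \<inter> W \<subseteq> H"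
proof -
  obtain Q where Q: "Q \<subseteq> P" "H = \<Inter>(cut s \<alpha> ` Q) \<inter> W" "\<forall>q\<in>P. \<exists>p\<in>Q. q \<notin> cut s \<alpha> p"
    using risp_correct(2)[OF assms(1-4,6)] by blast
  show "polyhedron H"
    unfolding Q using assms Q(1)
    by (intro polyhedron_Int polyhedron_Inter)
      (auto intro: polyhedron_cut polyhedron_halfspace_description finite_subset)
  show "bounded H"
    unfolding Q using assms by (simp add: bounded_Int)
  show "\<forall>p\<in>P. strictly_separated H p"
    using Q by (meson INT_lower inf.coboundedI1 strictly_separated_cut)
  show "cball s r \<inter> W \<subseteq> H" if "\<forall>p\<in>P. r \<le> (1 - \<alpha>) * dist p s"
    using that cball_subset_cut Q(1) unfolding Q(2) by fastforce
qed

section \<open>The exit point of a segment\<close>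

text \<open>Distance from \<open>a\<close> orders the points of the segment as their parameters do.
  The exit point is compared with other points through this order.\<close>

lemma closed_segment_linear_order:
  fixes a b :: "'a::euclidean_space"
  assumes "w \<in> closed_segment a b" "z \<in> closed_segment a b" "dist a z \<le> dist a w"
  shows "w \<in> closed_segment z b"
proof (cases "a = b")
  case True
  then show ?thesis using assms by simp
next
  case False
  obtain u v where u: "0 \<le> u" "u \<le> 1" "w = a + u *\<^sub>R (b - a)"
    and v: "0 \<le> v" "v \<le> 1" "z = a + v *\<^sub>R (b - a)"
    using assms(1,2) by (auto simp: in_segment algebra_simps)
  have "v * norm (b - a) \<le> u * norm (b - a)"
    using assms(3) u v by (simp add: dist_norm)
  then have "v \<le> u"
    using False by simp
  show ?thesis
  proof (cases "v = 1")
    case True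
    then show ?thesis using u v \<open>v \<le> u\<close> by (auto simp: in_segment intro: exI[of _ 0])
  next
    case False
    then have "v < 1" using v by simp
    \<comment> \<open>The parameter of \<open>w\<close> on the segment from \<open>z\<close> to
      \<open>b\<close>; the case \<open>v = 1\<close>, where \<open>z\<close> is already
      \<open>b\<close>, was split off to avoid dividing by zero.\<close>
    let ?t = "(u - v) / (1 - v)"
    have "w = (1 - ?t) *\<^sub>R z + ?t *\<^sub>R b"
    proof -
      have *: "?t * (1 - v) = u - v" using \<open>v < 1\<close> by simp
      have "(1 - t) *\<^sub>R z + t *\<^sub>R b = a + (v + t * (1 - v)) *\<^sub>R (b - a)" for t
        unfolding v(3) by (simp add: algebra_simps)
      then have "(1 - ?t) *\<^sub>R z + ?t *\<^sub>R b = a + (v + ?t * (1 - v)) *\<^sub>R (b - a)" .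
      then show ?thesis unfolding * u(3) by simp
    qed
    moreover have "0 \<le> ?t" "?t \<le> 1"
      using \<open>v < 1\<close> \<open>v \<le> u\<close> u by auto
    ultimately show ?thesis unfolding in_segment by blast
  qed
qed

text \<open>The description by \<open>THE\<close> is met by the point \<open>w\<close> of the
  segment in \<open>H\<close> nearest to \<open>v\<close>, which exists by compactness.\<close>

lemma polyline_intersect_correct:
  fixes H :: "'a::euclidean_space set"
  assumes "closed H" "x \<in> H" "v \<notin> H"
  defines "z \<equiv> polyline_intersect H x v"
  shows "z \<in> H" "z \<in> closed_segment x v" "closed_segment z v \<inter> H = {z}"
proof -
  let ?S = "closed_segment x v"
  let ?P = "\<lambda>z. z \<in> frontier H \<inter> ?S \<and> closed_segment z v \<inter> H = {z}"
  have "compact (?S \<inter> H)" "?S \<inter> H \<noteq> {}"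
    using assms by (auto intro: compact_Int_closed)
  then obtain w where w: "w \<in> ?S \<inter> H" "\<forall>w'\<in>?S \<inter> H. dist v w \<le> dist v w'"
    using distance_attains_inf[of "?S \<inter> H" v] by (metis compact_imp_closed)
  have wv: "w \<noteq> v"
    using w assms by auto
  \<comment> \<open>Another point of \<open>H\<close> between \<open>w\<close> and \<open>v\<close>
    would be nearer to \<open>v\<close>.\<close>
  have eq: "w' = w" if "w' \<in> closed_segment w v" "w' \<in> H" for w'
  proof (rule ccontr)
    assume "w' \<noteq> w"
    moreover have "w' \<in> ?S"
      using that(1) w(1) by (meson IntD1 ends_in_segment(2) subset_closed_segment subsetD)
    then have "dist v w \<le> dist v w'"
      using that w by auto
    moreover have "dist w v = dist w w' + dist w' v"
      using that(1) by (metis between_mem_segment between)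
    ultimately show False
      by (simp add: dist_commute)
  qed
  have "w \<notin> interior H"
  proof
    assume "w \<in> interior H"
    then obtain e where e: "e > 0" "ball w e \<subseteq> H"
      by (meson mem_interior)
    \<comment> \<open>A step towards \<open>v\<close> that is short enough to stay in the ball and,
      being capped by 1, on the segment.\<close>
    define t where "t = min 1 (e / 2 / dist w v)"
    have d: "dist w v > 0" using wv by simp
    have t: "0 < t" "t \<le> 1" "t * dist w v < e"
      using e d by (auto simp: t_def min_def field_simps)
    let ?w = "(1 - t) *\<^sub>R w + t *\<^sub>R v"
    have "?w \<in> closed_segment w v"
      using t unfolding in_segment by (intro exI[of _ t]) simp
    moreover have "?w - w = t *\<^sub>R (v - w)"
      by (simp add: algebra_simps)
    then have "dist w ?w = \<bar>t\<bar> * dist w v"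
      by (simp only: dist_norm norm_minus_commute[of w] norm_scaleR)
    then have "dist w ?w = t * dist w v" "?w \<noteq> w"
      using t d by auto
    then have "?w \<in> H"
      using t e by auto
    ultimately show False
      using eq \<open>?w \<noteq> w\<close> by blast
  qed
  moreover have "w \<in> closure H" using w closure_subset by blast
  ultimately have Pw: "?P w"
    using w eq by (auto simp: frontier_def)
  \<comment> \<open>Uniqueness: of two candidates, the one further from \<open>x\<close> lies
    between the other and \<open>v\<close>, where \<open>H\<close> has no second point.\<close>
  moreover have "w' = w" if "?P w'" for w'
  proof -
    have w': "w' \<in> ?S" "w' \<in> H"
      using that by auto
    show ?thesis
    proof (cases "dist x w \<le> dist x w'")
      case True
      then show ?thesis
        using closed_segment_linear_order[of w' x v w] w w' eq by auto
    next
      case False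
      then have "w \<in> closed_segment w' v"
        using closed_segment_linear_order[of w x v w'] w w' by auto
      then have "w \<in> closed_segment w' v \<inter> H"
        using w(1) by simp
      then show ?thesis
        using that by simp
    qed
  qed
  ultimately have "z = w"
    unfolding z_def polyline_intersect_def by (rule the_equality)
  then show "z \<in> H" "z \<in> ?S" "closed_segment z v \<inter> H = {z}"
    using w Pw by auto
qed

text \<open>The point of the segment at distance \<open>r\<close> from \<open>x\<close> lies in
  \<open>H\<close>. An earlier exit point would leave it behind in \<open>H\<close>, against the
  choice of the exit point.\<close>

lemma polyline_intersect_progress:
  fixes H :: "'a::euclidean_space set"
  assumes "closed H" "x \<in> H" "v \<notin> H" "0 < r"
    and "cball x r \<inter> closed_segment x v \<subseteq> H"
  shows "r \<le> dist x (polyline_intersect H x v)"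
proof (rule ccontr)
  let ?z = "polyline_intersect H x v"
  note z = polyline_intersect_correct[OF assms(1-3)]
  assume less: "\<not> r \<le> dist x ?z"
  \<comment> \<open>Otherwise the ball would contain \<open>v\<close> and force it into
    \<open>H\<close>; this puts the parameter \<open>?t\<close> below 1.\<close>
  have d: "dist x v > r"
    using assms by (metis IntI ends_in_segment(2) mem_cball not_le subsetD)
  let ?t = "r / dist x v"
  let ?w = "(1 - ?t) *\<^sub>R x + ?t *\<^sub>R v"
  have t: "0 \<le> ?t" "?t \<le> 1"
    using d assms(4) by (auto simp: divide_simps)
  then have wS: "?w \<in> closed_segment x v"
    unfolding in_segment by blast
  have "?w - x = ?t *\<^sub>R (v - x)"
    by (simp add: algebra_simps)
  then have "dist x ?w = \<bar>?t\<bar> * dist x v"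
    by (simp only: dist_norm norm_minus_commute[of x] norm_scaleR)
  then have dw: "dist x ?w = r"
    using d assms(4) by auto
  then have "?w \<in> H"
    using wS assms(5) by auto
  moreover have "?w \<in> closed_segment ?z v"
  proof (rule closed_segment_linear_order[OF wS z(2)])
    show "dist x ?z \<le> dist x ?w"
      unfolding dw using less by linarith
  qed
  ultimately have "?w = ?z"
    using z(3) by blast
  then show False
    using dw less by simp
qed

section \<open>The covering loop\<close>

text \<open>The obstacles are replaced by what the loop needs: the path stays in \<open>W\<close>
  and keeps a uniform margin from \<open>P\<close>. Since \<open>0 - 1 = 0\<close>, the case
  \<open>l = 0\<close> is the point \<open>y 0\<close>, the first seed.\<close>

locale path_cover_setting =
  fixes HW :: "'a::euclidean_space set set" and W P :: "'a set"
    and y :: "nat \<Rightarrow> 'a" and L :: nat and \<alpha> r :: real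
  assumes desc: "halfspace_description HW W" and bounded_W: "bounded W"
    and finite_P: "finite P" and alpha: "0 < \<alpha>" "\<alpha> < 1" and r_pos: "0 < r"
    and path_in_W: "l \<le> L \<Longrightarrow> closed_segment (y (l - 1)) (y l) \<subseteq> W"
    and path_far: "l \<le> L \<Longrightarrow> x \<in> closed_segment (y (l - 1)) (y l) \<Longrightarrow> p \<in> P \<Longrightarrow>
      r \<le> (1 - \<alpha>) * dist p x"
begin

definition region :: "'a set \<Rightarrow> bool" where
  "region H \<longleftrightarrow> polyhedron H \<and> bounded H \<and> (\<forall>p\<in>P. strictly_separated H p)"

definition chain_cover :: "'a set list \<Rightarrow> bool" where
  "chain_cover G \<longleftrightarrow> (\<forall>H\<in>set G. region H) \<and>
    (\<forall>j. Suc j < length G \<longrightarrow> G ! j \<inter> G ! Suc j \<noteq> {})"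

definition tail_length :: "nat \<Rightarrow> real" where
  "tail_length l = (\<Sum>k=l..<L. dist (y k) (y (Suc k)))"

lemma tail_length_nonneg: "0 \<le> tail_length l"
  by (simp add: tail_length_def sum_nonneg)

lemma tail_length_Suc: "l < L \<Longrightarrow> tail_length l = dist (y l) (y (Suc l)) + tail_length (Suc l)"
  by (simp add: tail_length_def sum.atLeast_Suc_lessThan)

text \<open>The flag \<open>seeded\<close> says that \<open>x\<close> is the seed of \<open>H\<close>.  The index \<open>l - 1\<close> is truncated: for
  \<open>l = 0\<close> the current segment is the single point \<open>y 0\<close>.\<close>

definition invar :: "bool \<Rightarrow> 'a set \<Rightarrow> 'a \<Rightarrow> nat \<Rightarrow> 'a set list \<Rightarrow> bool" where
  "invar seeded H x l G \<longleftrightarrow>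
    l \<le> L \<and> x \<in> closed_segment (y (l - 1)) (y l) \<and> x \<in> H \<and> G \<noteq> [] \<and> last G = H \<and>
    chain_cover G \<and>
    polyline y (l - 1) \<union> closed_segment (y (l - 1)) x \<subseteq> \<Union>(set G) \<and>
    (seeded \<longrightarrow> cball x r \<inter> W \<subseteq> H) \<and>
    r * length G + dist x (y l) + tail_length l \<le>
      tail_length 0 + r * l + (if seeded then r else 0)"

lemma seed_notin_P:
  assumes "l \<le> L" "x \<in> closed_segment (y (l - 1)) (y l)"
  shows "x \<notin> P"
  using path_far[OF assms, of x] r_pos by auto

lemma risp_on_path:
  assumes "l \<le> L" "x \<in> closed_segment (y (l - 1)) (y l)"
  shows "lossless_spmf (risp HW x P \<alpha>)"
    and "H \<in> set_spmf (risp HW x P \<alpha>) \<Longrightarrow> region H \<and> cball x r \<inter> W \<subseteq> H \<and> x \<in> H"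
proof -
  note x = seed_notin_P[OF assms]
  show "lossless_spmf (risp HW x P \<alpha>)"
    by (rule risp_correct(1)[OF finite_P x alpha(1) desc])
  assume H: "H \<in> set_spmf (risp HW x P \<alpha>)"
  note out = risp_output[OF finite_P x alpha(1) desc bounded_W H]
  have "cball x r \<inter> W \<subseteq> H"
    using path_far[OF assms] by (intro out(4)) auto
  moreover have "x \<in> W"
    using path_in_W assms by blast
  ultimately show "region H \<and> cball x r \<inter> W \<subseteq> H \<and> x \<in> H"
    using out(1-3) r_pos by (auto simp: region_def)
qed

lemma region_closed_convex:
  assumes "region H"
  shows "closed H" "convex H"
  using assms by (auto simp: region_def polyhedron_imp_closed polyhedron_imp_convex)

lemma invar_region:
  assumes "invar b H x l G"
  shows "region H" "H \<subseteq> \<Union>(set G)"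
  using assms last_in_set[of G] unfolding invar_def chain_cover_def by auto

lemma polyline_step:
  "polyline y l \<subseteq> polyline y (l - 1) \<union> closed_segment (y (l - 1)) (y l)"
  by (cases l) (auto simp: polyline_def atLeastAtMostSuc_conv)

text \<open>The path up to \<open>x\<close> is covered by the invariant, and by convexity
  \<open>H\<close> contains the rest of the segment.\<close>

lemma polyline_covered:
  assumes "invar b H x l G" "y l \<in> H"
  shows "polyline y l \<subseteq> \<Union>(set G)"
proof -
  have "closed_segment x (y l) \<subseteq> H"
    using assms invar_region[OF assms(1)] region_closed_convex
    by (intro closed_segment_subset) (auto simp: invar_def)
  moreover have "closed_segment (y (l - 1)) (y l) \<subseteq>
      closed_segment (y (l - 1)) x \<union> closed_segment x (y l)"
    using assms(1) Un_closed_segment[of x "y (l - 1)" "y l"] by (auto simp: invar_def)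
  ultimately show ?thesis
    using polyline_step[of l] invar_region(2)[OF assms(1)] assms(1) unfolding invar_def by blast
qed

text \<open>In the length inequality, the allowance for a seeded \<open>x\<close> is given up, and
  the increase of \<open>r * l\<close> by \<open>r\<close> makes up for it.\<close>

lemma invar_advance:
  assumes "invar b H x l G" "y l \<in> H" "l < L"
  shows "invar False H (y l) (Suc l) G"
proof -
  have "0 \<le> dist x (y l)" "(if b then r else 0) \<le> r"
    using r_pos by auto
  then have "r * length G + dist (y l) (y (Suc l)) + tail_length (Suc l) \<le>
      tail_length 0 + r * Suc l"
    using assms(1) tail_length_Suc[OF assms(3)] unfolding invar_def
    by (simp only: of_nat_Suc distrib_left) linarith
  then show ?thesis
    using assms polyline_covered[OF assms(1,2)] invar_region(2)[OF assms(1)]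
    unfolding invar_def by auto
qed

lemma chain_cover_snoc:
  assumes "chain_cover G" "G \<noteq> []" "region H" "last G \<inter> H \<noteq> {}"
  shows "chain_cover (G @ [H])"
proof -
  have "(G @ [H]) ! j \<inter> (G @ [H]) ! Suc j \<noteq> {}" if "Suc j < length (G @ [H])" for j
  proof (cases "Suc j < length G")
    case True
    then show ?thesis
      using assms(1) by (simp add: chain_cover_def nth_append)
  next
    case False
    with that have "Suc j = length G"
      by simp
    moreover from this have "G ! j = last G"
      using assms(2) by (metis diff_Suc_1 last_conv_nth)
    ultimately show ?thesis
      using assms(4) by (simp add: nth_append)
  qed
  then show ?thesis
    using assms(1,3) by (auto simp: chain_cover_def)
qed

text \<open>The exit point lies in the old and the new polytope, so consecutive ones meet. In the
  length inequality, the new polytope costs \<open>r\<close> and is paid by its own seed allowance;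
  the old allowance, if there was one, is repaid by the progress from \<open>x\<close> to
  \<open>z\<close>.\<close>

lemma invar_extend:
  assumes inv: "invar b H x l G" and out: "y l \<notin> H"
  defines "z \<equiv> polyline_intersect H x (y l)"
  assumes H': "H' \<in> set_spmf (risp HW z P \<alpha>)"
  shows "invar True H' z l (G @ [H'])"
proof -
  have l: "l \<le> L" and xS: "x \<in> closed_segment (y (l - 1)) (y l)" and xH: "x \<in> H"
    and G: "G \<noteq> []" "last G = H" "chain_cover G"
    and cov: "polyline y (l - 1) \<union> closed_segment (y (l - 1)) x \<subseteq> \<Union>(set G)"
    and ball: "b \<Longrightarrow> cball x r \<inter> W \<subseteq> H"
    and budget: "r * length G + dist x (y l) + tail_length l \<le>
      tail_length 0 + r * l + (if b then r else 0)"
    using inv by (auto simp: invar_def)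
  note reg = invar_region[OF inv]
  note H = region_closed_convex[OF reg(1)]
  note z = polyline_intersect_correct[OF H(1) xH out, folded z_def]
  have sub: "closed_segment x (y l) \<subseteq> closed_segment (y (l - 1)) (y l)"
    using xS by (simp add: subset_closed_segment)
  with z(2) have zS: "z \<in> closed_segment (y (l - 1)) (y l)"
    by blast
  note new = risp_on_path(2)[OF l zS H']
  have "closed_segment x z \<subseteq> H"
    using H xH z by (simp add: closed_segment_subset)
  moreover have "closed_segment (y (l - 1)) z \<subseteq> closed_segment (y (l - 1)) x \<union> closed_segment x z"
  proof -
    have "x \<in> closed_segment (y (l - 1)) z"
    proof -
      \<comment> \<open>The order lemma is applied to the reversed segment, on which
        \<open>z\<close> comes no later than \<open>x\<close>.\<close>
      have "dist (y l) x \<ge> dist (y l) z"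
        using dist_in_closed_segment[OF z(2)] by (simp add: dist_commute)
      then show ?thesis
        using closed_segment_linear_order[of x "y l" "y (l - 1)" z] xS zS
        by (simp add: closed_segment_commute)
    qed
    then show ?thesis
      by (simp add: Un_closed_segment)
  qed
  ultimately have "closed_segment (y (l - 1)) z \<subseteq> \<Union>(set G)"
    using cov reg(2) by (meson Un_subset_iff order_trans Un_least)
  then have "polyline y (l - 1) \<union> closed_segment (y (l - 1)) z \<subseteq> \<Union>(set (G @ [H']))"
    using cov by (simp add: le_supI2)
  moreover have "chain_cover (G @ [H'])"
    using G new z(1) by (intro chain_cover_snoc) auto
  \<comment> \<open>For a seeded \<open>x\<close> the ball is known to lie in \<open>H\<close> only
    within \<open>W\<close>, so that the segment stays in \<open>W\<close> is essential
    here.\<close>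
  moreover have "(if b then r else 0) \<le> dist x z"
    using polyline_intersect_progress[OF H(1) xH out r_pos, folded z_def] ball
      path_in_W[OF l] sub by auto
  moreover have "dist x (y l) = dist x z + dist z (y l)"
    using z(2) by (metis between_mem_segment between)
  ultimately show ?thesis
    using l zS new budget unfolding invar_def by (simp add: algebra_simps)
qed

section \<open>Termination and correctness of the loop\<close>

definition good_cover :: "'a set list \<Rightarrow> bool" where
  "good_cover G \<longleftrightarrow> chain_cover G \<and> polyline y L \<subseteq> \<Union>(set G)"

text \<open>The remaining path length in the invariant is nonnegative; dropping it and using
  \<open>l \<le> L\<close> leaves a bound that holds for every random choice.\<close>

lemma invar_length:
  assumes "invar b H x l G"
  shows "length G \<le> tail_length 0 / r + L + 1"
proof -
  have "r * l \<le> r * L" "(if b then r else 0) \<le> r"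
    using assms r_pos by (auto simp: invar_def)
  then have "r * length G \<le> tail_length 0 + r * L + r"
    using assms tail_length_nonneg[of l] zero_le_dist[of x "y l"] unfolding invar_def by linarith
  then show ?thesis
    using r_pos by (simp add: field_simps)
qed

text \<open>\<open>N\<close> exceeds every reachable list length, so the exit at
  \<open>max_iter\<close> is never taken. Advancing to a waypoint decreases \<open>L - l\<close>,
  and adding a polytope decreases \<open>N - length G\<close>, strictly because
  \<open>length G < N\<close>.\<close>

lemma path_cover_loop_correct:
  assumes "invar b H x l G" "tail_length 0 / r + L + 1 < N" "enat N \<le> max_iter"
  defines "R \<equiv> path_cover_loop HW y L P max_iter \<alpha>"
  shows "lossless_spmf (R H x l G) \<and> (\<forall>G'\<in>set_spmf (R H x l G). good_cover G')"
  using assms(1)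
proof (induction "(L - l) + (N - length G)" arbitrary: b H x l G rule: less_induct)
  case less
  note inv = less.prems
  have lL: "l \<le> L"
    using inv by (simp add: invar_def)
  have len: "length G < N"
    using invar_length[OF inv] assms(2) by linarith
  then have no_exit: "enat (length G) \<noteq> max_iter"
    using assms(3) by auto
  consider "y L \<in> H" "l = L" | "y l \<in> H" "l < L" | "y l \<notin> H"
    using lL by fastforce
  then show ?case
  proof cases
    case 1
    then have "R H x l G = return_spmf G"
      unfolding R_def by (subst path_cover_loop.simps) simp
    moreover have "good_cover G"
      using inv polyline_covered[OF inv] 1 by (simp add: good_cover_def invar_def)
    ultimately show ?thesis
      by simp
  next
    case 2
    then have "R H x l G = R H (y l) (Suc l) G"
      unfolding R_def by (subst path_cover_loop.simps) simp
    then show ?thesis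
      using less.hyps[OF _ invar_advance[OF inv 2]] 2 by simp
  next
    case 3
    let ?z = "polyline_intersect H x (y l)"
    have "y L \<notin> H \<or> l < L"
      using 3 lL by (cases "l = L") auto
    then have unfold: "R H x l G = bind_spmf (risp HW ?z P \<alpha>) (\<lambda>H'. R H' ?z l (G @ [H']))"
      unfolding R_def using 3 no_exit by (subst path_cover_loop.simps) simp
    have "?z \<in> closed_segment x (y l)"
      using polyline_intersect_correct(2) inv 3 invar_region[OF inv] region_closed_convex
      by (metis invar_def)
    then have "?z \<in> closed_segment (y (l - 1)) (y l)"
      using inv subset_closed_segment[of x "y l" "y (l - 1)" "y l"] by (auto simp: invar_def)
    note risp = risp_on_path(1)[OF lL this]
    have "lossless_spmf (R H' ?z l (G @ [H'])) \<and>
        (\<forall>G'\<in>set_spmf (R H' ?z l (G @ [H'])). good_cover G')"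
      if "H' \<in> set_spmf (risp HW ?z P \<alpha>)" for H'
      using less.hyps[OF _ invar_extend[OF inv 3 that]] len by simp
    then show ?thesis
      using risp by (auto simp: unfold set_bind_spmf)
  qed
qed

lemma path_cover_correct:
  assumes "tail_length 0 / r + L + 1 < N" "enat N \<le> max_iter"
  shows "lossless_spmf (path_cover HW y L P max_iter \<alpha>) \<and>
    (\<forall>G\<in>set_spmf (path_cover HW y L P max_iter \<alpha>). good_cover G)"
proof -
  have y0: "y 0 \<in> closed_segment (y (0 - 1)) (y 0)"
    by simp
  note risp = risp_on_path[OF le0 y0]
  \<comment> \<open>The length inequality starts with equality: the allowance of the first seed pays
    for the first polytope.\<close>
  have "invar True H (y 0) 0 [H]" if "H \<in> set_spmf (risp HW (y 0) P \<alpha>)" for H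
    using risp(2)[OF that] by (auto simp: invar_def chain_cover_def polyline_def)
  then show ?thesis
    using risp(1) path_cover_loop_correct[OF _ assms]
    by (fastforce simp: path_cover_def set_bind_spmf)
qed

end

section \<open>The margin of the path and the length bound\<close>

theorem theorem1:
  fixes W Obs F P :: "(real ^ 'n) set"
    and HW :: "(real ^ 'n) set set"
    and y :: "nat \<Rightarrow> real ^ 'n"
    and L :: nat
    and \<alpha> :: real
  assumes "CARD('n) = 2 \<or> CARD('n) = 3"
    and "bounded W"
    and "halfspace_description HW W"
    and "Obs \<subseteq> W"
    and "closedin (top_of_set W) Obs"
    and "F = W - Obs"
    and "finite P"
    and "P \<subseteq> frontier Obs"
    and "\<forall>l\<le>L. y l \<in> F"
    and "\<forall>l\<in>{1..L}. closed_segment (y (l - 1)) (y l) \<subseteq> interior F"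
    and "0 < \<alpha>" and "\<alpha> < 1"
  shows "\<exists>N::nat. \<forall>max_iter\<ge>enat N.
    lossless_spmf (path_cover HW y L P max_iter \<alpha>) \<and>
    (\<forall>G\<in>set_spmf (path_cover HW y L P max_iter \<alpha>).
       (\<forall>H\<in>set G. polyhedron H \<and> bounded H) \<and>
       (\<forall>H\<in>set G. \<forall>p\<in>P. strictly_separated H p) \<and>
       (\<forall>j. Suc j < length G \<longrightarrow> G ! j \<inter> G ! Suc j \<noteq> {}) \<and>
       polyline y L \<subseteq> \<Union>(set G))"
proof -
  \<comment> \<open>The term for \<open>l = 0\<close> adds the point \<open>y 0\<close>, which
    matters for \<open>L = 0\<close>, when there are no segments.\<close>
  define K where "K = (\<Union>l\<le>L. closed_segment (y (l - 1)) (y l))"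
  have F: "closed_segment (y (l - 1)) (y l) \<subseteq> F" if "l \<le> L" for l
  proof (cases l)
    case 0
    then show ?thesis using assms(9) by simp
  next
    case (Suc k)
    then show ?thesis
      using assms(10) that interior_subset[of F] by fastforce
  qed
  have "closed W"
    using assms(3) by (simp add: polyhedron_halfspace_description polyhedron_imp_closed)
  then have "closed Obs"
    using assms(5) closedin_closed_trans by blast
  then have "P \<subseteq> Obs"
    using assms(8) frontier_subset_closed by blast
  then have "K \<inter> P = {}"
    using F assms(6) by (fastforce simp: K_def)
  moreover have "compact K"
    unfolding K_def by (intro compact_UN) auto
  ultimately obtain \<delta> where \<delta>: "\<delta> > 0" "\<forall>x\<in>K. \<forall>p\<in>P. \<delta> \<le> dist x p"
    using separate_compact_closed[of K P] finite_imp_closed[OF assms(7)] by blast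
  \<comment> \<open>Each seed \<open>x\<close> on the path has distance at least \<delta> from all
    samples, so this radius serves for all cuts at once.\<close>
  define r where "r = (1 - \<alpha>) * \<delta>"
  interpret path_cover_setting HW W P y L \<alpha> r
  proof
    show "closed_segment (y (l - 1)) (y l) \<subseteq> W" if "l \<le> L" for l
      using F[OF that] assms(6) by blast
    show "r \<le> (1 - \<alpha>) * dist p x"
      if "l \<le> L" "x \<in> closed_segment (y (l - 1)) (y l)" "p \<in> P" for l x p
      using \<delta>(2) that assms(12)
      unfolding r_def K_def dist_commute[of p] by (intro mult_left_mono) auto
  qed (use assms \<delta> in \<open>auto simp: r_def\<close>)
  \<comment> \<open>The bound depends only on the path, \<open>P\<close> and \<alpha>, so one
    \<open>N\<close> serves for all \<open>max_iter\<close> and all random choices.\<close>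
  obtain N :: nat where "tail_length 0 / r + L + 1 < N"
    using reals_Archimedean2 by blast
  from path_cover_correct[OF this] show ?thesis
    unfolding good_cover_def chain_cover_def region_def by blast
qed

end
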